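(* Let $p$ be a prime with $p\equiv 2$ or $3\pmod 5$ and let $r$ be a positive integer. The code $G_p(r,2)$ attains the anticode bound $\mathcal{A}_p(2r+2,4,2)\le\dfrac{p^{2r+2}-1}{p^2-1}$; that is, $G_p(r,2)$ is a set of $2$-dimensional subspaces of $\mathbb{F}_p^{2r+2}$ with minimum subspace distance $4$ and $|G_p(r,2)|=\dfrac{p^{2r+2}-1}{p^2-1}$.
   Context: Fix $\omega \in \mathbb{F}_{p^2}$ such that $\{1,\omega\}$ is an $\mathbb{F}_p$-basis of $\mathbb{F}_{p^2}$. For each positive integer $i$ the map $\phi_O:\mathbb{F}_{p^2}^i\to M_{2\times 2i}(\mathbb{F}_p)$ is defined, for $c_j,d_j\in\mathbb{F}_p$, by $$\phi_O((c_1+d_1\omega,\dots,c_i+d_i\omega))=\begin{pmatrix} d_1&c_1&d_2&c_2&\cdots&d_i&c_i\\ c_1+d_1&d_1&c_2+d_2&d_2&\cdots&c_i+d_i&d_i\end{pmatrix}.$$ $\langle M\rangle$ denotes the row space of a matrix $M$. For $1\le i\le r$ let $$D_i=\left\{\left\langle\begin{pmatrix}0_{2\times(2r-2i)} & I_2 & A\end{pmatrix}\right\rangle : A\in\phi_O(\mathbb{F}_{p^2}^i)\right\},$$ a set of subspaces of $\mathbb{F}_p^{2r+2}$, let $\widehat H_2=(0_{2\times 2r}\ \ I_2)$, and define $G_p(r,2)=\{\langle\widehat H_2\rangle\}\cup\bigcup_{i=1}^r D_i$. The subspace distance is $d_S(U,V)=\dim U+\dim V-2\dim(U\cap V)$.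 $\mathcal{A}_q(n,d,k)$ denotes the maximum number of codewords of a set of $k$-dimensional subspaces of $\mathbb{F}_q^n$ with minimum subspace distance $d$. The anticode bound states $\mathcal{A}_q(n,2\delta+2,k)\le {n\brack k-\delta}_q\big/{k\brack k-\delta}_q$, where ${n\brack k}_q=\prod_{i=0}^{k-1}\frac{q^n-q^i}{q^k-q^i}$; for $q=p$, $n=2r+2$, $\delta=1$, $k=2$ the right-hand side is $\frac{p^{2r+2}-1}{p^2-1}$. *)

theory Defs
  imports
    "Jordan_Normal_Form.VS_Connect"
    "Berlekamp_Zassenhaus.Finite_Field"
begin

section \<open>Constant-dimension subspace codes\<close>

text \<open>Subspaces of \<open>F\<^sup>n\<close>, for a field \<open>F\<close> given as a type \<open>'a\<close>, are sets of vectors of length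
  \<open>n\<close> that are subspaces of \<open>module_vec TYPE('a) n\<close>.\<close>

definition is_subspace :: "nat \<Rightarrow> 'a::field vec set \<Rightarrow> bool" where
  "is_subspace n U \<longleftrightarrow> VectorSpace.subspace class_ring U (module_vec TYPE('a) n)"

definition sdim :: "nat \<Rightarrow> 'a::field vec set \<Rightarrow> nat" where
  "sdim n U = vectorspace.dim class_ring ((module_vec TYPE('a) n)\<lparr>carrier := U\<rparr>)"

text \<open>Integer-valued, so that the subtraction is not truncated.\<close>

definition subspace_dist :: "nat \<Rightarrow> 'a::field vec set \<Rightarrow> 'a vec set \<Rightarrow> int" where
  "subspace_dist n U V = int (sdim n U) + int (sdim n V) - 2 * int (sdim n (U \<inter> V))"

text \<open>The minimum is required to be attained, so a code with fewer than two codewords has no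
  minimum distance.\<close>

definition has_min_dist :: "nat \<Rightarrow> 'a::field vec set set \<Rightarrow> int \<Rightarrow> bool" where
  "has_min_dist n C d \<longleftrightarrow>
     (\<exists>U\<in>C. \<exists>V\<in>C. U \<noteq> V \<and> subspace_dist n U V = d) \<and>
     (\<forall>U\<in>C. \<forall>V\<in>C. U \<noteq> V \<longrightarrow> d \<le> subspace_dist n U V)"

definition subspace_code :: "nat \<Rightarrow> int \<Rightarrow> nat \<Rightarrow> 'a::field vec set set \<Rightarrow> bool" where
  "subspace_code n d k C \<longleftrightarrow>
     (\<forall>U\<in>C. is_subspace n U \<and> sdim n U = k) \<and> has_min_dist n C d"

text \<open>\<open>\<A>\<^sub>q(n,d,k)\<close>, where \<open>q\<close> is the order of the finite field \<open>'a\<close>.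
  Only meaningful if some code with these parameters exists.\<close>

definition max_code_size :: "'a::{field,finite} itself \<Rightarrow> nat \<Rightarrow> int \<Rightarrow> nat \<Rightarrow> nat" where
  "max_code_size _ n d k = Max {card C | C :: 'a vec set set. subspace_code n d k C}"

section \<open>The code \<open>G\<^sub>p(r,2)\<close>\<close>

text \<open>The prime field \<open>\<F>\<^sub>p\<close> is \<open>'p mod_ring\<close> with \<open>p = CARD('p)\<close>; \<open>\<F>\<^sub>p\<^sup>2\<close> is any field type \<open>'k\<close>
  with \<open>p\<^sup>2\<close> elements. Such a \<open>'k\<close> has characteristic \<open>p\<close>, and then the following map is the
  (unique) embedding of \<open>\<F>\<^sub>p\<close>.\<close>

definition fp_embed :: "'p::prime_card mod_ring \<Rightarrow> 'k::field" where
  "fp_embed c = of_int (to_int_mod_ring c)"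

definition fp_scale :: "'p::prime_card mod_ring \<Rightarrow> 'k::field \<Rightarrow> 'k" where
  "fp_scale c x = fp_embed c * x"

definition fp_basis_1 :: "'p::prime_card itself \<Rightarrow> 'k::field \<Rightarrow> bool" where
  "fp_basis_1 _ \<omega> \<longleftrightarrow>
     1 \<noteq> \<omega> \<and>
     \<not> Modules.module.dependent (fp_scale :: 'p mod_ring \<Rightarrow> 'k \<Rightarrow> 'k) {1, \<omega>} \<and>
     Modules.module.span (fp_scale :: 'p mod_ring \<Rightarrow> 'k \<Rightarrow> 'k) {1, \<omega>} = UNIV"

text \<open>The coordinates \<open>(c, d)\<close> of \<open>x = c + d\<omega>\<close>.\<close>

definition fp_coords :: "'k::field \<Rightarrow> 'k \<Rightarrow> 'p::prime_card mod_ring \<times> 'p mod_ring" where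
  "fp_coords \<omega> x = (THE (c, d). x = fp_embed c + fp_embed d * \<omega>)"

text \<open>Matrix and vector indices start at 0: columns \<open>2j\<close> and \<open>2j + 1\<close> belong to
  the entry with index \<open>j\<close>.\<close>

definition phi_O :: "'k::field \<Rightarrow> 'k vec \<Rightarrow> 'p::prime_card mod_ring mat" where
  "phi_O \<omega> x = mat 2 (2 * dim_vec x) (\<lambda>(a, b).
     let (c, d) = fp_coords \<omega> (x $ (b div 2))
     in if a = 0 then (if even b then d else c)
        else (if even b then c + d else d))"

definition append_cols :: "'a::zero mat \<Rightarrow> 'a mat \<Rightarrow> 'a mat" where
  "append_cols A B = four_block_mat A B (0\<^sub>m 0 (dim_col A)) (0\<^sub>m 0 (dim_col B))"

definition row_span :: "'a::field mat \<Rightarrow> 'a vec set" where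
  "row_span M = vec_space.row_space (dim_col M) M"

definition D_code :: "'k::field \<Rightarrow> nat \<Rightarrow> nat \<Rightarrow> 'p::prime_card mod_ring vec set set" where
  "D_code \<omega> r i =
     {row_span (append_cols (0\<^sub>m 2 (2 * r - 2 * i)) (append_cols (1\<^sub>m 2) A)) | A.
        A \<in> phi_O \<omega> ` carrier_vec i}"

definition G_code :: "'k::field \<Rightarrow> nat \<Rightarrow> 'p::prime_card mod_ring vec set set" where
  "G_code \<omega> r =
     {row_span (append_cols (0\<^sub>m 2 (2 * r)) (1\<^sub>m 2))} \<union> (\<Union>i\<in>{1..r}. D_code \<omega> r i)"

end

theory Submission
  imports Defs "HOL-Number_Theory.Quadratic_Reciprocity"
begin

text \<open>The matrix \<open>(d, c; c + d, d)\<close> has determinant \<open>d\<^sup>2 - c(c + d)\<close>, a quadratic form in \<open>(c, d)\<close> of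
  discriminant 5. For odd \<open>p\<close>, 5 is a non-residue modulo \<open>p\<close> by quadratic reciprocity, so the form is
  anisotropic; for \<open>p = 2\<close> it is \<open>c\<^sup>2 + cd + d\<^sup>2\<close>, again anisotropic. So the nonzero matrices of this shape, a linear family, are invertible. Hence two row spaces
  \<open>\<langle>0 I A\<rangle>\<close> and \<open>\<langle>0 I B\<rangle>\<close> with \<open>A \<noteq> B\<close> of the same width meet only in 0; for different widths the
  identity blocks force this. So the code is a partial spread, and its size \<open>1 + p\<^sup>2 + \<dots> + p\<^sup>2\<^sup>r\<close> is that of
  a spread. The upper bound counts nonzero vectors, each lying in at most one codeword.\<close>

section \<open>Counting in finite vector spaces: dimension as the exponent of the
  cardinality\<close>

text \<open>Every vector has unique coordinates in a finite basis \<open>B\<close>, so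
  \<open>lincomb\<close> is a bijection from the extensional functions
  \<open>B \<rightarrow>\<^sub>E carrier K\<close> onto the space.\<close>

lemma (in vectorspace) card_carrier_eq_power_dim:
  assumes "finite (carrier V)"
  shows "card (carrier V) = card (carrier K) ^ dim"
proof -
  \<comment> \<open>The finite carrier is itself a finite generating set.\<close>
  have "fin_dim"
    unfolding fin_dim_def using assms span_is_subset2[of "carrier V"] in_own_span[of "carrier V"]
    by (intro exI[of _ "carrier V"]) auto
  then obtain B where B: "finite B" "basis B"
    using finite_basis_exists by blast
  have sub: "B \<subseteq> carrier V"
    using B(2) by (simp add: basis_def)
  have crit: "\<exists>!a. a \<in> B \<rightarrow>\<^sub>E carrier K \<and> lincomb a B = v" if "v \<in> carrier V" for v
    by (rule mp[OF spec[OF iffD1[OF basis_criterion[OF B(1) sub] B(2)]] that])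
  have closed: "lincomb a B \<in> carrier V" if "a \<in> B \<rightarrow>\<^sub>E carrier K" for a
    using that sub by (intro lincomb_closed) auto
  have "bij_betw (\<lambda>a. lincomb a B) (B \<rightarrow>\<^sub>E carrier K) (carrier V)"
    unfolding bij_betw_def
  proof (intro conjI equalityI subsetI)
    show "inj_on (\<lambda>a. lincomb a B) (B \<rightarrow>\<^sub>E carrier K)"
    proof (rule inj_onI)
      fix a b assume "a \<in> B \<rightarrow>\<^sub>E carrier K" "b \<in> B \<rightarrow>\<^sub>E carrier K" "lincomb a B = lincomb b B"
      then show "a = b"
        using crit[OF closed, of b] by blast
    qed
    show "v \<in> (\<lambda>a. lincomb a B) ` (B \<rightarrow>\<^sub>E carrier K)" if "v \<in> carrier V" for v
      using crit[OF that] by blast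
    show "v \<in> carrier V" if "v \<in> (\<lambda>a. lincomb a B) ` (B \<rightarrow>\<^sub>E carrier K)" for v
      using that closed by blast
  qed
  then have "card (carrier V) = card (B \<rightarrow>\<^sub>E carrier K)"
    by (rule bij_betw_same_card[symmetric])
  also have "\<dots> = card (carrier K) ^ card B"
    using B(1) by (simp add: card_PiE)
  finally show ?thesis
    using B dim_basis by simp
qed

lemma bij_betw_vec_carrier_vec: "bij_betw (vec n) ({..<n} \<rightarrow>\<^sub>E UNIV) (carrier_vec n)"
proof (rule bij_betwI[where g = "\<lambda>v. restrict (($) v) {..<n}"])
  show "restrict (($) (vec n f)) {..<n} = f" if "f \<in> {..<n} \<rightarrow>\<^sub>E UNIV" for f :: "nat \<Rightarrow> 'a"
    using that by (intro ext) (auto simp: restrict_def PiE_def extensional_def)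
qed auto

lemma card_carrier_vec: "card (carrier_vec n :: 'a::finite vec set) = CARD('a) ^ n"
  using bij_betw_same_card[OF bij_betw_vec_carrier_vec[of n, where 'a = 'a]]
  by (simp add: card_PiE)

lemma finite_carrier_vec: "finite (carrier_vec n :: 'a::finite vec set)"
  by (rule card_ge_0_finite) (simp add: card_carrier_vec)

lemma is_subspace_subset: "is_subspace n U \<Longrightarrow> U \<subseteq> carrier_vec n"
  by (auto simp: is_subspace_def VectorSpace.subspace_def LinearCombinations.submodule_def module_vec_simps)

lemma zero_in_subspace: "is_subspace n U \<Longrightarrow> 0\<^sub>v n \<in> U"
  by (auto simp: is_subspace_def VectorSpace.subspace_def LinearCombinations.submodule_def module_vec_simps)

lemma is_subspace_Int: "is_subspace n U \<Longrightarrow> is_subspace n V \<Longrightarrow> is_subspace n (U \<inter> V)"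
  by (auto simp: is_subspace_def VectorSpace.subspace_def LinearCombinations.submodule_def)

lemma card_subspace:
  fixes U :: "'a::{field,finite} vec set"
  assumes "is_subspace n U"
  shows "card U = CARD('a) ^ sdim n U"
proof -
  interpret vectorspace "class_ring :: 'a ring" "(module_vec TYPE('a) n)\<lparr>carrier := U\<rparr>"
    using assms vectorspace.subspace_is_vs[OF vec_vs] by (auto simp: is_subspace_def)
  have "finite U"
    using is_subspace_subset[OF assms] finite_carrier_vec finite_subset by blast
  then show ?thesis
    using card_carrier_eq_power_dim by (simp add: sdim_def class_ring_simps)
qed

text \<open>A field has at least two elements, so its powers determine their exponents. This lets
  later dimensions be found by counting alone.\<close>

lemma sdim_eq_iff:
  fixes U :: "'a::{field,finite} vec set"
  assumes "is_subspace n U"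
  shows "sdim n U = k \<longleftrightarrow> card U = CARD('a) ^ k"
proof -
  have "card {0, 1 :: 'a} \<le> CARD('a)"
    by (rule card_mono) auto
  then show ?thesis
    by (simp add: card_subspace[OF assms])
qed

section \<open>Row spaces of matrices with two rows\<close>

text \<open>The row space is the image of the transpose. Two scalars \<open>a\<close>,
  \<open>b\<close> make membership in a codeword accessible column by column.\<close>

lemma row_span_two_rows:
  fixes M :: "'a::field mat"
  assumes "M \<in> carrier_mat 2 n"
  shows "row_span M = range (\<lambda>(a, b). vec n (\<lambda>k. a * M $$ (0, k) + b * M $$ (1, k)))"
    (is "_ = range ?f")
proof -
  have mult: "M\<^sup>T *\<^sub>v y = ?f (y $ 0, y $ 1)" if "y \<in> carrier_vec 2" for y
    using assms that
    by (intro eq_vecI) (auto simp: scalar_prod_def numeral_2_eq_2 algebra_simps)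
  have "row_span M = {w \<in> carrier_vec n. \<exists>y\<in>carrier_vec 2. M\<^sup>T *\<^sub>v y = w}"
    using vec_space.row_space_eq[OF assms] assms by (simp add: row_span_def)
  also have "\<dots> = range ?f"
  proof (intro equalityI subsetI)
    fix w assume "w \<in> range ?f"
    then obtain a b where w: "w = ?f (a, b)"
      by auto
    have "M\<^sup>T *\<^sub>v vec_of_list [a, b] = w"
      unfolding w by (subst mult) (auto intro: carrier_vecI)
    moreover have "vec_of_list [a, b] \<in> carrier_vec 2"
      by (auto intro: carrier_vecI)
    moreover have "w \<in> carrier_vec n"
      unfolding w by simp
    ultimately show "w \<in> {w \<in> carrier_vec n. \<exists>y\<in>carrier_vec 2. M\<^sup>T *\<^sub>v y = w}"
      by blast
  qed (auto simp: mult)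
  finally show ?thesis .
qed

lemma is_subspace_row_span:
  fixes M :: "'a::field mat"
  assumes "M \<in> carrier_mat m n"
  shows "is_subspace n (row_span M)"
proof -
  have "set (rows M) \<subseteq> carrier_vec n"
    using assms rows_carrier[of M] by auto
  then show ?thesis
    using vectorspace.span_is_subspace[OF vec_vs, of "set (rows M)" n] assms
    by (simp add: is_subspace_def row_span_def vec_space.row_space_def module_vec_simps)
qed

section \<open>Anisotropy of the quadratic form\<close>

text \<open>A square root of 5 would make 5 a residue modulo the odd prime \<open>p\<close>.
  Reciprocity would then make \<open>p\<close> a residue modulo 5, whereas the squares modulo 5 are
  0, 1 and 4.\<close>

lemma five_not_square:
  assumes "[CARD('p::prime_card) = 2] (mod 5) \<or> [CARD('p) = 3] (mod 5)" "CARD('p) \<noteq> 2"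
  shows "(t :: 'p mod_ring) ^ 2 \<noteq> 5"
proof
  assume t: "t ^ 2 = 5"
  define p where "p = CARD('p)"
  have p: "prime p" "2 < p" "p \<noteq> 5"
    using assms prime_card[where 'a = 'p] prime_ge_2_nat[of p] by (auto simp: p_def cong_def)
  have "of_int (to_int_mod_ring t) = t"
    by (simp add: of_int_of_int_mod_ring)
  then have "of_int (to_int_mod_ring t ^ 2 - 5) = (0 :: 'p mod_ring)"
    using t by simp
  then have "int p dvd to_int_mod_ring t ^ 2 - 5"
    by (simp only: of_int_eq_0_iff_char_dvd semiring_char_mod_ring p_def)
  then have "QuadRes (int p) 5"
    by (auto simp: QuadRes_def cong_iff_dvd_diff)
  \<comment> \<open>Excludes the degenerate value 0 of the Legendre symbol.\<close>
  moreover have "\<not> [5 = 0] (mod int p)"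
  proof
    assume "[5 = 0] (mod int p)"
    then have "p dvd 5"
      by (metis cong_0_iff int_dvd_int_iff of_nat_numeral)
    then show False
      using p primes_dvd_imp_eq[of p 5] by auto
  qed
  ultimately have "Legendre 5 (int p) = 1"
    by (simp add: Legendre_def)
  \<comment> \<open>The exponent is even because \<open>(5 - 1) div 2 = 2\<close>, so both symbols
    have product 1.\<close>
  moreover have "Legendre (int p) (int 5) * Legendre (int 5) (int p) = (-1) ^ ((p - 1) div 2 * ((5 - 1) div 2))"
    using p by (intro Quadratic_Reciprocity) auto
  ultimately have "Legendre (int p) 5 = 1"
    by simp
  then have "QuadRes 5 (int p)"
    by (auto simp: Legendre_def split: if_splits)
  then obtain y where y: "[y ^ 2 = int p] (mod 5)"
    by (auto simp: QuadRes_def)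
  have "y mod 5 = 0 \<or> y mod 5 = 1 \<or> y mod 5 = 2 \<or> y mod 5 = 3 \<or> y mod 5 = 4"
    by presburger
  moreover have "y ^ 2 mod 5 = (y mod 5) ^ 2 mod 5"
    by (simp only: power_mod)
  ultimately have "y ^ 2 mod 5 \<in> {0, 1, 4}"
    by fastforce
  moreover have "p mod 5 = 2 \<or> p mod 5 = 3"
    using assms(1) by (simp add: p_def cong_def)
  then have "int p mod 5 = 2 \<or> int p mod 5 = 3"
    by presburger
  ultimately show False
    using y by (auto simp: cong_def)
qed

text \<open>Completing the square turns a zero of the form into
  \<open>(2 * d - c) ^ 2 = 5 * c ^ 2\<close>, which for \<open>c \<noteq> 0\<close> exhibits 5 as a
  square. In characteristic 2, where 5 = 1 is a square, the few values are checked directly.\<close>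

lemma phi_O_form_anisotropic:
  fixes c d :: "'p::prime_card mod_ring"
  assumes "[CARD('p) = 2] (mod 5) \<or> [CARD('p) = 3] (mod 5)"
    and "d ^ 2 = c * (c + d)"
  shows "c = 0 \<and> d = 0"
proof (cases "c = 0")
  case True
  then show ?thesis
    using assms(2) by simp
next
  case False
  show ?thesis
  proof (cases "CARD('p) = 2")
    case True
    have "card {0, 1 :: 'p mod_ring} = 2"
      by simp
    then have "UNIV = {0, 1 :: 'p mod_ring}"
      using True by (intro card_subset_eq[symmetric]) auto
    then have "c \<in> {0, 1}" "d \<in> {0, 1}"
      by blast+
    moreover have "(1 + 1 :: 'p mod_ring) = 0"
      using of_nat_card_eq_0[where 'a = 'p] True by simp
    ultimately show ?thesis
      using assms(2) False by auto
  next
    case odd: False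
    have "(2 * d - c) ^ 2 = 4 * d ^ 2 - 4 * (c * d) + c ^ 2"
      by (simp add: power2_eq_square algebra_simps)
    also have "\<dots> = 5 * c ^ 2"
      unfolding assms(2) by (simp add: power2_eq_square algebra_simps)
    finally have "((2 * d - c) / c) ^ 2 = 5"
      using False by (simp add: power_divide)
    then show ?thesis
      using five_not_square[OF assms(1) odd] by blast
  qed
qed

section \<open>Coordinates of the quadratic extension over the prime field\<close>

text \<open>The characteristic of \<open>'k\<close> is a prime dividing \<open>CARD('p) ^ 2\<close>,
  hence equals \<open>CARD('p)\<close>. So reducing an integer modulo \<open>CARD('p)\<close> does
  not change its image in \<open>'k\<close>.\<close>

lemma fp_embed_hom:
  fixes x y :: "'p::prime_card mod_ring"
  assumes "CARD('k::{field,finite}) = CARD('p) ^ 2"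
  shows "fp_embed (x + y) = (fp_embed x + fp_embed y :: 'k)"
    and "fp_embed (x * y) = (fp_embed x * fp_embed y :: 'k)"
    and "fp_embed (1 :: 'p mod_ring) = (1 :: 'k)"
proof -
  have "CHAR('k) dvd CARD('p) ^ 2"
    using CHAR_dvd_CARD[where 'a = 'k] assms by simp
  moreover have "prime CHAR('k)"
    by (intro prime_CHAR_semidom finite_imp_CHAR_pos) simp
  ultimately have "CHAR('k) = CARD('p)"
    using prime_dvd_power primes_dvd_imp_eq prime_card by blast
  then have mod: "of_int (z mod int CARD('p)) = (of_int z :: 'k)" for z
    using of_int_mod_CHAR[of z, where 'a = 'k] by simp
  show "fp_embed (x + y) = (fp_embed x + fp_embed y :: 'k)"
    by (simp add: fp_embed_def to_int_mod_ring_add mod)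
  show "fp_embed (x * y) = (fp_embed x * fp_embed y :: 'k)"
    by (simp add: fp_embed_def to_int_mod_ring_mult mod)
  show "fp_embed (1 :: 'p mod_ring) = (1 :: 'k)"
    by (simp add: fp_embed_def)
qed

text \<open>Spanning gives surjectivity, and both sides have \<open>CARD('p) ^ 2\<close>
  elements.\<close>

lemma bij_fp_basis_1:
  fixes \<omega> :: "'k::{field,finite}"
  assumes card: "CARD('k) = CARD('p::prime_card) ^ 2" and basis: "fp_basis_1 TYPE('p) \<omega>"
  shows "bij (\<lambda>(c :: 'p mod_ring, d :: 'p mod_ring). fp_embed c + fp_embed d * \<omega>)"
    (is "bij ?f")
proof -
  have mod: "Modules.module (fp_scale :: 'p mod_ring \<Rightarrow> 'k \<Rightarrow> 'k)"
    by unfold_locales (simp_all add: fp_scale_def fp_embed_hom[OF card] algebra_simps)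
  have "UNIV = Modules.module.span (fp_scale :: 'p mod_ring \<Rightarrow> 'k \<Rightarrow> 'k) {1, \<omega>}"
    using basis by (simp add: fp_basis_1_def)
  also have "\<dots> = range (\<lambda>u. \<Sum>v\<in>{1, \<omega>}. fp_scale (u v :: 'p mod_ring) v)"
    by (intro module.span_finite[OF mod]) simp
  also have "\<dots> \<subseteq> range ?f"
  proof (intro image_subsetI)
    fix u :: "'k \<Rightarrow> 'p mod_ring"
    \<comment> \<open>The part \<open>1 \<noteq> \<omega>\<close> of the basis condition splits the
      sum into two separate terms.\<close>
    show "(\<Sum>v\<in>{1, \<omega>}. fp_scale (u v) v) \<in> range ?f"
      using basis by (intro image_eqI[of _ _ "(u 1, u \<omega>)"]) (auto simp: fp_basis_1_def fp_scale_def)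
  qed
  finally have surj: "surj ?f"
    by blast
  moreover have "CARD('p mod_ring \<times> 'p mod_ring) = CARD('k)"
    by (simp add: card power2_eq_square)
  ultimately show ?thesis
    by (simp add: bij_def eq_card_imp_inj_on)
qed

text \<open>Bijectivity makes the definite description well defined, so recombining the coordinates
  is a left inverse.\<close>

lemma inj_fp_coords:
  fixes \<omega> :: "'k::{field,finite}"
  assumes "CARD('k) = CARD('p::prime_card) ^ 2" and "fp_basis_1 TYPE('p) \<omega>"
  shows "inj (fp_coords \<omega> :: 'k \<Rightarrow> 'p mod_ring \<times> 'p mod_ring)"
proof (rule inj_on_inverseI)
  fix x :: 'k
  let ?f = "\<lambda>z :: 'p mod_ring \<times> 'p mod_ring. fp_embed (fst z) + fp_embed (snd z) * \<omega>"
  have "bij ?f"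
    using bij_fp_basis_1[OF assms] by (simp add: case_prod_beta')
  then have "\<exists>!z. x = ?f z"
    unfolding bij_iff by metis
  then have "x = ?f (THE z. x = ?f z)"
    by (rule theI')
  then show "?f (fp_coords \<omega> x) = x"
    by (simp add: fp_coords_def case_prod_beta')
qed

section \<open>Generator matrices and a uniform parametrisation of the code\<close>

lemma append_cols_carrier:
  "A \<in> carrier_mat m n \<Longrightarrow> B \<in> carrier_mat m k \<Longrightarrow> append_cols A B \<in> carrier_mat m (n + k)"
  by (auto simp: append_cols_def)

lemma index_append_cols:
  assumes "A \<in> carrier_mat m n" "B \<in> carrier_mat m k" "i < m" "j < n + k"
  shows "append_cols A B $$ (i, j) = (if j < n then A $$ (i, j) else B $$ (i, j - n))"
  using assms by (auto simp: append_cols_def)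

text \<open>All codewords at once: those of \<open>D\<^sub>i\<close> come from vectors \<open>x\<close> of length \<open>i\<close>, and \<open>\<langle>H\<^sub>2\<rangle>\<close> from the
  vector of length 0.\<close>

definition generator :: "'k::field \<Rightarrow> nat \<Rightarrow> 'k vec \<Rightarrow> 'p::prime_card mod_ring mat" where
  "generator \<omega> r x =
     append_cols (0\<^sub>m 2 (2 * r - 2 * dim_vec x)) (append_cols (1\<^sub>m 2) (phi_O \<omega> x))"

lemma phi_O_carrier: "phi_O \<omega> x \<in> carrier_mat 2 (2 * dim_vec x)"
  by (simp add: phi_O_def)

lemma generator_carrier:
  assumes "dim_vec x \<le> r"
  shows "generator \<omega> r x \<in> carrier_mat 2 (2 * r + 2)"
proof -
  have "generator \<omega> r x \<in> carrier_mat 2 (2 * r - 2 * dim_vec x + (2 + 2 * dim_vec x))"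
    unfolding generator_def by (intro append_cols_carrier phi_O_carrier) auto
  then show ?thesis
    using assms by simp
qed

lemma index_generator:
  assumes "dim_vec x \<le> r" "i < 2" "k < 2 * r + 2"
  shows "generator \<omega> r x $$ (i, k) =
    (let m = 2 * r - 2 * dim_vec x
     in if k < m then 0
        else if k < m + 2 then (if i = k - m then 1 else 0)
        else phi_O \<omega> x $$ (i, k - m - 2))"
proof -
  define m where "m = 2 * r - 2 * dim_vec x"
  have AB: "append_cols (1\<^sub>m 2) (phi_O \<omega> x) \<in> carrier_mat 2 (2 + 2 * dim_vec x)"
    by (intro append_cols_carrier phi_O_carrier) auto
  \<comment> \<open>The bound \<open>dim_vec x \<le> r\<close> makes the truncated subtraction in
    \<open>m\<close> exact.\<close>
  have m: "m + (2 + 2 * dim_vec x) = 2 * r + 2"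
    using assms(1) by (simp add: m_def)
  have "generator \<omega> r x $$ (i, k) =
      (if k < m then 0\<^sub>m 2 m $$ (i, k) else append_cols (1\<^sub>m 2) (phi_O \<omega> x) $$ (i, k - m))"
    unfolding generator_def m_def[symmetric]
    by (intro index_append_cols[OF _ AB]) (use assms m in auto)
  moreover have "append_cols (1\<^sub>m 2) (phi_O \<omega> x) $$ (i, k - m) =
      (if k - m < 2 then 1\<^sub>m 2 $$ (i, k - m) else phi_O \<omega> x $$ (i, k - m - 2))" if "m \<le> k"
    by (intro index_append_cols[OF _ phi_O_carrier]) (use assms m that in auto)
  ultimately show ?thesis
    using assms by (auto simp: Let_def m_def[symmetric])
qed

lemma index_phi_O:
  assumes "j < dim_vec x" "fp_coords \<omega> (x $ j) = (c, d)"
  shows "phi_O \<omega> x $$ (0, 2 * j) = d" "phi_O \<omega> x $$ (0, 2 * j + 1) = c"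
    and "phi_O \<omega> x $$ (1, 2 * j) = c + d" "phi_O \<omega> x $$ (1, 2 * j + 1) = d"
  using assms by (auto simp: phi_O_def)

lemma G_code_eq:
  fixes \<omega> :: "'k::field"
  shows "(G_code \<omega> r :: 'p::prime_card mod_ring vec set set) =
    (\<lambda>x. row_span (generator \<omega> r x)) ` {x. dim_vec x \<le> r}"
proof -
  let ?U = "\<lambda>x :: 'k vec. row_span (generator \<omega> r x) :: 'p mod_ring vec set"
  \<comment> \<open>For length 0 the block \<open>phi_O \<omega> x\<close> has no columns, which is
    how the exceptional codeword fits the pattern.\<close>
  have one: "append_cols (1\<^sub>m 2) (phi_O \<omega> x) = (1\<^sub>m 2 :: 'p mod_ring mat)"
    if "dim_vec x = 0" for x
  proof (rule eq_matI)
    have c: "(phi_O \<omega> x :: 'p mod_ring mat) \<in> carrier_mat 2 0"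
      using phi_O_carrier[of \<omega> x] that by simp
    show "dim_row (append_cols (1\<^sub>m 2) (phi_O \<omega> x :: 'p mod_ring mat)) = dim_row (1\<^sub>m 2 :: 'p mod_ring mat)"
      and "dim_col (append_cols (1\<^sub>m 2) (phi_O \<omega> x :: 'p mod_ring mat)) = dim_col (1\<^sub>m 2 :: 'p mod_ring mat)"
      using append_cols_carrier[OF one_carrier_mat c] by auto
    show "append_cols (1\<^sub>m 2) (phi_O \<omega> x) $$ (i, j) = (1\<^sub>m 2 :: 'p mod_ring mat) $$ (i, j)"
      if "i < dim_row (1\<^sub>m 2 :: 'p mod_ring mat)" "j < dim_col (1\<^sub>m 2 :: 'p mod_ring mat)" for i j
      using index_append_cols[OF one_carrier_mat c, of i j] that by simp
  qed
  then have zero: "row_span (append_cols (0\<^sub>m 2 (2 * r)) (1\<^sub>m 2)) = ?U x" if "dim_vec x = 0" for x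
    using that by (simp only: generator_def mult_0_right diff_zero)
  have D: "V \<in> D_code \<omega> r i \<longleftrightarrow> (\<exists>x. dim_vec x = i \<and> V = ?U x)" for V i
    unfolding D_code_def generator_def carrier_vec_def by blast
  have "V \<in> G_code \<omega> r \<longleftrightarrow> (\<exists>x. dim_vec x \<le> r \<and> V = ?U x)" for V
  proof
    assume "V \<in> G_code \<omega> r"
    then consider "V = row_span (append_cols (0\<^sub>m 2 (2 * r)) (1\<^sub>m 2))"
      | i where "i \<in> {1..r}" "V \<in> D_code \<omega> r i"
      unfolding G_code_def by blast
    then show "\<exists>x. dim_vec x \<le> r \<and> V = ?U x"
    proof cases
      case 1
      then show ?thesis
        using zero[of "0\<^sub>v 0"] by (intro exI[of _ "0\<^sub>v 0"] conjI) (simp_all only: index_zero_vec)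
    next
      case 2
      then show ?thesis
        unfolding D by force
    qed
  next
    assume "\<exists>x. dim_vec x \<le> r \<and> V = ?U x"
    then obtain x where x: "dim_vec x \<le> r" "V = ?U x"
      by blast
    show "V \<in> G_code \<omega> r"
    proof (cases "dim_vec x = 0")
      case True
      then show ?thesis
        unfolding G_code_def x(2) zero[OF True] by blast
    next
      case False
      have "V \<in> D_code \<omega> r (dim_vec x)"
        unfolding D using x(2) by blast
      moreover have "dim_vec x \<in> {1..r}"
        unfolding atLeastAtMost_iff using False x(1) by linarith
      ultimately show ?thesis
        unfolding G_code_def by blast
    qed
  qed
  then show ?thesis
    by blast
qed

lemma dim_vec_le_eq_UN: "{x. dim_vec x \<le> r} = (\<Union>i\<le>r. carrier_vec i)"
  unfolding carrier_vec_def by blast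

lemma card_dim_vec_le: "card {x :: 'a::finite vec. dim_vec x \<le> r} = (\<Sum>i\<le>r. CARD('a) ^ i)"
proof -
  have "card (\<Union>i\<le>r. carrier_vec i :: 'a vec set) = (\<Sum>i\<le>r. card (carrier_vec i :: 'a vec set))"
  proof (rule card_UN_disjoint)
    show "\<forall>i\<in>{..r}. \<forall>j\<in>{..r}. i \<noteq> j \<longrightarrow> carrier_vec i \<inter> carrier_vec j = ({} :: 'a vec set)"
      unfolding carrier_vec_def by blast
  qed (simp_all add: finite_carrier_vec)
  then show ?thesis
    by (simp only: dim_vec_le_eq_UN card_carrier_vec)
qed

section \<open>The codewords form a partial spread of planes\<close>

text \<open>A common vector is compared at the identity block of \<open>y\<close>, the one starting
  no later. If the lengths differ, \<open>?X\<close> vanishes there and so do the coefficients. If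
  they agree, both pairs of coefficients coincide and are annihilated by an invertible 2 by 2 block,
  the difference of the blocks at an entry where \<open>x\<close> and \<open>y\<close>
  differ.\<close>

lemma row_spans_of_generators_meet_trivially_aux:
  fixes \<omega> :: "'k::field" and v :: "'p::prime_card mod_ring vec"
  assumes p: "[CARD('p) = 2] (mod 5) \<or> [CARD('p) = 3] (mod 5)"
    and inj: "inj (fp_coords \<omega> :: 'k \<Rightarrow> 'p mod_ring \<times> 'p mod_ring)"
    and le: "dim_vec x \<le> dim_vec y" "dim_vec y \<le> r" and "x \<noteq> y"
    and v: "v \<in> row_span (generator \<omega> r x)" "v \<in> row_span (generator \<omega> r y)"
  shows "v = 0\<^sub>v (2 * r + 2)"
proof -
  let ?X = "generator \<omega> r x :: 'p mod_ring mat" and ?Y = "generator \<omega> r y :: 'p mod_ring mat"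
  have x: "dim_vec x \<le> r"
    using le by simp
  obtain a b where a: "v = vec (2 * r + 2) (\<lambda>k. a * ?X $$ (0, k) + b * ?X $$ (1, k))"
    using v(1) unfolding row_span_two_rows[OF generator_carrier[OF x]] by auto
  obtain a' b' where a': "v = vec (2 * r + 2) (\<lambda>k. a' * ?Y $$ (0, k) + b' * ?Y $$ (1, k))"
    using v(2) unfolding row_span_two_rows[OF generator_carrier[OF le(2)]] by auto
  have eq: "a * ?X $$ (0, k) + b * ?X $$ (1, k) = a' * ?Y $$ (0, k) + b' * ?Y $$ (1, k)"
    if "k < 2 * r + 2" for k
    using arg_cong[OF trans[OF a[symmetric] a'], of "\<lambda>w. w $ k"] that by simp
  note ind = index_generator[OF x] index_generator[OF le(2)]
  \<comment> \<open>The first column of the identity block of \<open>?Y\<close>.\<close>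
  define m where "m = 2 * r - 2 * dim_vec y"
  have m: "m + 2 + 2 * dim_vec y = 2 * r + 2"
    using le by (simp add: m_def)
  have "a' = 0 \<and> b' = 0"
  proof (cases "dim_vec x = dim_vec y")
    case False
    then have "m + 1 < 2 * r - 2 * dim_vec x"
      using le by (simp add: m_def)
    then show ?thesis
      using eq[of m] eq[of "m + 1"] m by (simp add: ind m_def[symmetric] Let_def)
  next
    case True
    then have ab: "a = a'" "b = b'"
      using eq[of m] eq[of "m + 1"] m by (simp_all add: ind m_def[symmetric] Let_def)
    obtain j where j: "j < dim_vec y" "x $ j \<noteq> y $ j"
      using True \<open>x \<noteq> y\<close> by (metis eq_vecI)
    obtain c d c' d' where cd: "fp_coords \<omega> (x $ j) = (c, d :: 'p mod_ring)"
        "fp_coords \<omega> (y $ j) = (c', d' :: 'p mod_ring)"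
      by fastforce
    define C D where "C = c - c'" and "D = d - d'"
    have "C \<noteq> 0 \<or> D \<noteq> 0"
      using inj_eq[OF inj, of "x $ j" "y $ j"] j(2) cd by (auto simp: C_def D_def)
    then have det: "D ^ 2 - C * (C + D) \<noteq> 0"
      using phi_O_form_anisotropic[OF p, of D C] by auto
    \<comment> \<open>These are the two columns that encode entry \<open>j\<close>, counted from the
      end of the identity block.\<close>
    have entries: "a * d + b * (c + d) = a * d' + b * (c' + d')" "a * c + b * d = a * c' + b * d'"
      using eq[of "m + 2 + 2 * j"] eq[of "m + 2 + (2 * j + 1)"] j(1) m True
        index_phi_O[OF _ cd(1)] index_phi_O[OF _ cd(2)]
      by (simp_all add: ind m_def[symmetric] Let_def ab)
    have rows: "a * D + b * (C + D) = 0" "a * C + b * D = 0"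
      using entries by (simp_all add: C_def D_def algebra_simps)
    \<comment> \<open>Cramer's rule: multiplying by the adjugate isolates the determinant times
      \<open>a\<close>, and below times \<open>b\<close>.\<close>
    have "a * (D ^ 2 - C * (C + D)) = D * (a * D + b * (C + D)) - (C + D) * (a * C + b * D)"
      by (simp add: power2_eq_square algebra_simps)
    moreover have "b * (D ^ 2 - C * (C + D)) = D * (a * C + b * D) - C * (a * D + b * (C + D))"
      by (simp add: power2_eq_square algebra_simps)
    ultimately show ?thesis
      using det ab unfolding rows by simp
  qed
  then show ?thesis
    unfolding a' by auto
qed

text \<open>The order of the lengths is removed by symmetry in \<open>x\<close> and
  \<open>y\<close>.\<close>

lemma row_spans_of_generators_meet_trivially:
  fixes \<omega> :: "'k::field"
  assumes "[CARD('p::prime_card) = 2] (mod 5) \<or> [CARD('p) = 3] (mod 5)"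
    and "inj (fp_coords \<omega> :: 'k \<Rightarrow> 'p mod_ring \<times> 'p mod_ring)"
    and dims: "dim_vec x \<le> r" "dim_vec y \<le> r" and "x \<noteq> y"
  shows "row_span (generator \<omega> r x) \<inter> row_span (generator \<omega> r y) =
    {0\<^sub>v (2 * r + 2) :: 'p mod_ring vec}"
proof -
  have sub: "is_subspace (2 * r + 2) (row_span (generator \<omega> r x) :: 'p mod_ring vec set)"
    "is_subspace (2 * r + 2) (row_span (generator \<omega> r y) :: 'p mod_ring vec set)"
    by (rule is_subspace_row_span[OF generator_carrier[OF dims(1)]])
      (rule is_subspace_row_span[OF generator_carrier[OF dims(2)]])
  have "v = 0\<^sub>v (2 * r + 2)"
    if v: "v \<in> row_span (generator \<omega> r x)" "v \<in> row_span (generator \<omega> r y)"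
    for v :: "'p mod_ring vec"
  proof (cases "dim_vec x \<le> dim_vec y")
    case True
    then show ?thesis
      by (rule row_spans_of_generators_meet_trivially_aux[OF assms(1,2) _ dims(2) \<open>x \<noteq> y\<close> v])
  next
    case False
    then have "dim_vec y \<le> dim_vec x"
      by simp
    then show ?thesis
      by (rule row_spans_of_generators_meet_trivially_aux[OF assms(1,2) _ dims(1) \<open>x \<noteq> y\<close>[symmetric] v(2,1)])
  qed
  then show ?thesis
    using sub[THEN zero_in_subspace] by blast
qed

text \<open>The identity block displays the coefficients \<open>a\<close> and \<open>b\<close> as
  two consecutive entries, so distinct pairs give distinct vectors, and counting gives the
  dimension.\<close>

lemma sdim_row_span_generator:
  fixes \<omega> :: "'k::field"
  assumes "dim_vec x \<le> r"
  shows "sdim (2 * r + 2) (row_span (generator \<omega> r x) :: 'p::prime_card mod_ring vec set) = 2"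
proof -
  let ?M = "generator \<omega> r x :: 'p mod_ring mat"
  let ?f = "\<lambda>(a, b). vec (2 * r + 2) (\<lambda>k. a * ?M $$ (0, k) + b * ?M $$ (1, k))"
  define m where "m = 2 * r - 2 * dim_vec x"
  have m: "m + 1 < 2 * r + 2"
    by (simp add: m_def)
  have "?f (a, b) $ m = a \<and> ?f (a, b) $ (m + 1) = b" for a b
    using m by (simp add: index_generator[OF assms] m_def[symmetric] Let_def)
  then have "inj ?f"
    by (intro inj_on_inverseI[where g = "\<lambda>v. (v $ m, v $ (m + 1))"]) auto
  then have "card (row_span ?M) = CARD('p mod_ring) ^ 2"
    unfolding row_span_two_rows[OF generator_carrier[OF assms]]
    by (simp add: card_image power2_eq_square)
  then show ?thesis
    using sdim_eq_iff[OF is_subspace_row_span[OF generator_carrier[OF assms]]] by blast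
qed

section \<open>The anticode bound as a packing bound\<close>

lemma sdim_zero_subspace:
  fixes U :: "'a::{field,finite} vec set"
  assumes "is_subspace n U"
  shows "sdim n U = 0 \<longleftrightarrow> U = {0\<^sub>v n}"
proof -
  have "card U = 1 \<longleftrightarrow> U = {0\<^sub>v n}"
    using zero_in_subspace[OF assms] unfolding One_nat_def card_1_singleton_iff by blast
  then show ?thesis
    by (simp add: sdim_eq_iff[OF assms])
qed

text \<open>The sets of nonzero vectors of the codewords are pairwise disjoint inside the nonzero
  vectors of the whole space. The product form avoids division of naturals.\<close>

lemma subspace_code_4_2_card_le:
  fixes C :: "'a::{field,finite} vec set set"
  assumes "subspace_code n 4 2 C"
  shows "card C * (CARD('a) ^ 2 - 1) \<le> CARD('a) ^ n - 1"
proof -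
  have C: "is_subspace n U" "sdim n U = 2" if "U \<in> C" for U
    using assms that by (auto simp: subspace_code_def)
  have disj: "(U - {0\<^sub>v n}) \<inter> (V - {0\<^sub>v n}) = {}" if "U \<in> C" "V \<in> C" "U \<noteq> V" for U V
  proof -
    have "4 \<le> subspace_dist n U V"
      using assms that by (auto simp: subspace_code_def has_min_dist_def)
    \<comment> \<open>Here 4 is at most 2 + 2 minus twice this dimension.\<close>
    then have "sdim n (U \<inter> V) = 0"
      using that C by (simp add: subspace_dist_def)
    then have "U \<inter> V = {0\<^sub>v n}"
      using sdim_zero_subspace[OF is_subspace_Int[OF C(1)[OF that(1)] C(1)[OF that(2)]]] by simp
    then show ?thesis
      by blast
  qed
  have sub: "U \<subseteq> carrier_vec n" if "U \<in> C" for U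
    using C(1)[OF that] by (rule is_subspace_subset)
  then have "C \<subseteq> Pow (carrier_vec n)"
    by blast
  then have fin: "finite C"
    by (rule finite_subset) (simp add: finite_carrier_vec)
  have card: "card (U - {0\<^sub>v n}) = CARD('a) ^ 2 - 1" if "U \<in> C" for U
    using card_subspace[OF C(1)[OF that]] zero_in_subspace[OF C(1)[OF that]] C(2)[OF that]
    by (simp add: card_Diff_singleton)
  have "card C * (CARD('a) ^ 2 - 1) = (\<Sum>U\<in>C. card (U - {0\<^sub>v n}))"
    using card by simp
  also have "\<dots> = card (\<Union>U\<in>C. U - {0\<^sub>v n})"
  proof (rule card_UN_disjoint[symmetric])
    show "\<forall>U\<in>C. finite (U - {0\<^sub>v n})"
      using finite_subset[OF sub finite_carrier_vec] by simp
  qed (use fin disj in simp_all)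
  also have "\<dots> \<le> card (carrier_vec n - {0\<^sub>v n :: 'a vec})"
    using sub by (intro card_mono finite_Diff finite_carrier_vec) blast
  also have "\<dots> = CARD('a) ^ n - 1"
    by (simp add: card_Diff_singleton card_carrier_vec)
  finally show ?thesis .
qed

text \<open>\<open>Max\<close> is attained only on a finite nonempty set: some code must exist, and
  all codes are subsets of the finite power set of \<open>carrier_vec n\<close>.\<close>

lemma max_code_size_4_2_le:
  assumes "subspace_code n 4 2 (C :: 'a::{field,finite} vec set set)"
  shows "max_code_size TYPE('a) n 4 2 * (CARD('a) ^ 2 - 1) \<le> CARD('a) ^ n - 1"
proof -
  let ?S = "{card C | C :: 'a vec set set. subspace_code n 4 2 C}"
  have "?S \<subseteq> card ` Pow (Pow (carrier_vec n :: 'a vec set))"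
  proof (intro subsetI, elim CollectE exE conjE)
    fix k and D :: "'a vec set set"
    assume D: "k = card D" "subspace_code n 4 2 D"
    then have "D \<in> Pow (Pow (carrier_vec n))"
      unfolding subspace_code_def using is_subspace_subset by blast
    then show "k \<in> card ` Pow (Pow (carrier_vec n :: 'a vec set))"
      unfolding D(1) by (rule imageI)
  qed
  then have "finite ?S"
    by (rule finite_subset) (simp add: finite_carrier_vec)
  moreover have "?S \<noteq> {}"
    using assms by blast
  ultimately have "max_code_size TYPE('a) n 4 2 \<in> ?S"
    unfolding max_code_size_def by (rule Max_in)
  then obtain D :: "'a vec set set"
    where "max_code_size TYPE('a) n 4 2 = card D" "subspace_code n 4 2 D"
    by blast
  then show ?thesis
    by (simp only: subspace_code_4_2_card_le)
qed

section \<open>Parameters and optimality of the code\<close>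

theorem mainTheorem4:
  fixes p r :: nat
    and \<omega> :: "'k::{field,finite}"
    and G :: "'p::prime_card mod_ring vec set set"
  assumes "prime p" and "CARD('p) = p"
    and "[p = 2] (mod 5) \<or> [p = 3] (mod 5)"
    and "r \<ge> 1"
    and "CARD('k) = p\<^sup>2"
    and "fp_basis_1 TYPE('p) \<omega>"
    and "G = G_code \<omega> r"
  shows "subspace_code (2 * r + 2) 4 2 G \<and>
     real (card G) = (real p ^ (2 * r + 2) - 1) / (real p ^ 2 - 1) \<and>
     real (max_code_size TYPE('p mod_ring) (2 * r + 2) 4 2)
       \<le> (real p ^ (2 * r + 2) - 1) / (real p ^ 2 - 1)"
proof -
  let ?n = "2 * r + 2"
  let ?U = "\<lambda>x. row_span (generator \<omega> r x) :: 'p mod_ring vec set"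
  let ?I = "{x :: 'k vec. dim_vec x \<le> r}"
  have p: "1 < p"
    using \<open>prime p\<close> by (rule prime_gt_1_nat)
  then have p2: "1 < real p ^ 2"
    by simp
  have G: "G = ?U ` ?I"
    using \<open>G = G_code \<omega> r\<close> by (simp add: G_code_eq)
  have inj_coords: "inj (fp_coords \<omega> :: 'k \<Rightarrow> 'p mod_ring \<times> 'p mod_ring)"
    by (rule inj_fp_coords) (use assms in simp_all)
  have sub: "is_subspace ?n (?U x)" if "dim_vec x \<le> r" for x
    by (rule is_subspace_row_span[OF generator_carrier[OF that]])
  have sdim: "sdim ?n (?U x) = 2" if "dim_vec x \<le> r" for x
    by (rule sdim_row_span_generator[OF that])
  have dist: "subspace_dist ?n (?U x) (?U y) = 4"
    if x: "dim_vec x \<le> r" and y: "dim_vec y \<le> r" and "x \<noteq> y" for x y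
  proof -
    have "?U x \<inter> ?U y = {0\<^sub>v ?n}"
      using row_spans_of_generators_meet_trivially[OF _ inj_coords x y \<open>x \<noteq> y\<close>] assms(2,3) by simp
    then have "sdim ?n (?U x \<inter> ?U y) = 0"
      using sdim_zero_subspace[OF is_subspace_Int[OF sub[OF x] sub[OF y]]] by simp
    then show ?thesis
      using sdim[OF x] sdim[OF y] by (simp add: subspace_dist_def)
  qed
  \<comment> \<open>A subspace has distance 0 from itself, so distance 4 already separates the
    codewords.\<close>
  have neq: "?U x \<noteq> ?U y" if "dim_vec x \<le> r" "dim_vec y \<le> r" "x \<noteq> y" for x y
  proof
    assume "?U x = ?U y"
    then have "subspace_dist ?n (?U y) (?U y) = 4"
      using dist[OF that] by simp
    then show False
      by (simp add: subspace_dist_def)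
  qed
  then have inj: "inj_on ?U ?I"
    unfolding inj_on_def by blast
  have min: "4 \<le> subspace_dist ?n U V" if UV: "U \<in> G" "V \<in> G" "U \<noteq> V" for U V
  proof -
    obtain x y where "dim_vec x \<le> r" "dim_vec y \<le> r" and U: "U = ?U x" "V = ?U y"
      using UV unfolding G by blast
    moreover from this UV(3) have "x \<noteq> y"
      by blast
    ultimately show ?thesis
      using dist[of x y] by simp
  qed
  \<comment> \<open>Attaining the minimum distance takes two codewords. Zero vectors of lengths 0
    and 1 supply them, the second because \<open>r \<ge> 1\<close>.\<close>
  have dims: "dim_vec (0\<^sub>v 0 :: 'k vec) \<le> r" "dim_vec (0\<^sub>v 1 :: 'k vec) \<le> r"
    using \<open>r \<ge> 1\<close> by simp_all
  have "0\<^sub>v 0 \<noteq> (0\<^sub>v 1 :: 'k vec)"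
    by (metis index_zero_vec(2) zero_neq_one)
  from neq[OF dims this] dist[OF dims this] dims
  have "\<exists>U\<in>G. \<exists>V\<in>G. U \<noteq> V \<and> subspace_dist ?n U V = 4"
    unfolding G by blast
  then have code: "subspace_code ?n 4 2 G"
    unfolding subspace_code_def has_min_dist_def
    using min sub sdim by (auto simp: G)
  \<comment> \<open>By injectivity the codewords are counted by their parameter vectors, sorted by
    length.\<close>
  have "card G = (\<Sum>i\<le>r. (p ^ 2) ^ i)"
    unfolding G card_image[OF inj] using card_dim_vec_le[of r, where 'a = 'k] assms(5) by simp
  then have "real (card G) = (\<Sum>i<Suc r. (real p ^ 2) ^ i)"
    by (simp add: lessThan_Suc_atMost)
  also have "\<dots> = ((real p ^ 2) ^ Suc r - 1) / (real p ^ 2 - 1)"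
    using p2 by (intro geometric_sum) simp
  also have "(real p ^ 2) ^ Suc r = real p ^ ?n"
    by (simp add: power_mult power2_eq_square algebra_simps)
  finally have card: "real (card G) = (real p ^ ?n - 1) / (real p ^ 2 - 1)" .
  have "max_code_size TYPE('p mod_ring) ?n 4 2 * (p ^ 2 - 1) \<le> p ^ ?n - 1"
    using max_code_size_4_2_le[OF code] assms(2) by simp
  then have "real (max_code_size TYPE('p mod_ring) ?n 4 2 * (p ^ 2 - 1)) \<le> real (p ^ ?n - 1)"
    by (rule of_nat_mono)
  then have "real (max_code_size TYPE('p mod_ring) ?n 4 2) * (real p ^ 2 - 1) \<le> real p ^ ?n - 1"
    using p by (simp add: of_nat_diff)
  then show ?thesis
    using code card p2 by (simp add: pos_le_divide_eq)
qed

end
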